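(* Let $f:\mathbb{R}^m\to(-\infty,+\infty]$ and $g:\mathbb{R}^n\to(-\infty,+\infty]$ be proper lower semicontinuous convex functions, $A\in\mathbb{R}^{n\times m}$ of full column rank, and let $R,S\in\mathbb{R}^{n\times n}$ be symmetric positive definite with $A^TRA$ positive definite. Put $L(x,y)=f(x)+\langle Ax,y\rangle-g(y)$ and assume that $L$ has at least one saddle point. Let $(\tau_k)_{k\ge0}$ and $(\lambda_k)_{k\ge0}$ be nondecreasing sequences of positive numbers with $R-\tau_k\lambda_kS^{-1}\succ0$ for all $k$, and suppose there are constants $\overline\tau,\overline\lambda$ with $\tau_k\le\overline\tau$, $\lambda_k\le\overline\lambda$ for all $k$ and $R-\overline\tau\,\overline\lambda S^{-1}\succ0$. Let $(x^{k+1},y^{k+1},\overline y^{k+1})_{k\ge0}$ be an inexact primal-dual sequence (defined in the context) with tolerances $\varepsilon_{k}\ge0$, $\delta_{k}\ge0$ ($k\ge 1$) and starting point $(x^0,\overline y^0)$, and for $N\ge1$ put $\widehat x^N=\frac1N\sum_{k=0}^{N-1}x^{k+1}$, $\widehat y^N=\frac1N\sum_{k=0}^{N-1}y^{k+1}$. Assume that the sums $$A_N=\sum_{k=0}^{N-1}\tau_N\sqrt{\frac{\varepsilon_{k+1}}{\tau_k}},\qquad B_N=\sum_{k=0}^{N-1}\tau_N(2\varepsilon_{k+1}+\delta_{k+1})$$ remain bounded as $N\to\infty$. Then every cluster point $(\widehat x,\widehat y)$ of the sequence $(\widehat x^N,\widehat y^N)_{N\ge1}$ is a saddle point of $L$.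 Moreover, there exists a saddle point $(\widehat x,\widehat y)\in\mathbb{R}^m\times\mathbb{R}^n$ of $L$ such that $x^k\to\widehat x$ and $y^k\to\widehat y$ as $k\to\infty$.
   Context: For a symmetric positive definite matrix $D$, $\|x\|_D^2=\langle x,Dx\rangle$; $M\succ0$ means that the symmetric matrix $M$ is positive definite. For a proper convex function $h$ and $\varepsilon\ge0$, the $\varepsilon$-subdifferential at $z\in\operatorname{dom}h$ is $\partial_\varepsilon h(z)=\{p: h(x)\ge h(z)+\langle p,x-z\rangle-\varepsilon\ \ \forall x\}$ (it is empty for $z\notin\operatorname{dom} h$). A point $(x^*,y^* )$ with $x^*\in\operatorname{dom}f$, $y^*\in\operatorname{dom}g$ is a saddle point of $L$ if $L(x^*,y)\le L(x^*,y^* )\le L(x,y^* )$ for all $x\in\mathbb{R}^m$, $y\in\mathbb{R}^n$. Inexact primal-dual sequence: given $x^0\in\mathbb{R}^m$, $\overline y^0\in\mathbb{R}^n$, step sizes $\tau_k,\lambda_k>0$ and tolerances $\varepsilon_{k+1},\delta_{k+1}\ge0$, a sequence $(x^{k+1},y^{k+1},\overline y^{k+1})_{k\ge0}$ is called an inexact primal-dual sequence if for every $k\ge0$: (1) $y^{k+1}$ is a type-2 approximation, with precision $\varepsilon_{k+1}/2$, of $\arg\max_y\{L(x^k,y)-\frac1{2\tau_k}\|y-\overline y^k\|_S^2\}$, i.e. $\frac1{\tau_k}S(\overline y^k-y^{k+1})+Ax^k\in\partial_{\varepsilon_{k+1}/2}\,g(y^{k+1})$; (2) $x^{k+1}$ is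 a type-2 approximation, with precision $\delta_{k+1}$, of $\arg\min_x\{L(x,y^{k+1})+\frac1{2\lambda_k}\|A(x-x^k)\|_R^2\}$, i.e. $\frac1{\lambda_k}A^TRA(x^k-x^{k+1})-A^Ty^{k+1}\in\partial_{\delta_{k+1}}f(x^{k+1})$; (3) $\overline y^{k+1}$ is a type-1 approximation, with precision $\varepsilon_{k+1}/2$, of $\arg\max_y\{L(x^{k+1},y)-\frac1{2\tau_k}\|y-\overline y^k\|_S^2\}$, i.e. $0\in\partial_{\varepsilon_{k+1}/2}\,G(\overline y^{k+1})$, where $G(y)=g(y)-\langle Ax^{k+1},y\rangle+\frac1{2\tau_k}\|y-\overline y^k\|_S^2$. *)

theory Defs
  imports "HOL-Analysis.Analysis"
begin

definition eff_dom :: "('a \<Rightarrow> ereal) \<Rightarrow> 'a set" where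
  "eff_dom h = {x. h x < \<infinity>}"

definition proper_fun :: "('a \<Rightarrow> ereal) \<Rightarrow> bool" where
  "proper_fun h \<longleftrightarrow> (\<forall>x. h x \<noteq> -\<infinity>) \<and> eff_dom h \<noteq> {}"

(* Only used for functions that avoid the value minus infinity, so the right-hand side never
   adds infinities of opposite sign; note that 0 * \<infinity> = 0 in ereal. *)
definition convex_fun :: "('a::real_vector \<Rightarrow> ereal) \<Rightarrow> bool" where
  "convex_fun h \<longleftrightarrow>
     (\<forall>x y. \<forall>u\<ge>0. \<forall>v\<ge>0. u + v = 1 \<longrightarrow>
        h (u *\<^sub>R x + v *\<^sub>R y) \<le> ereal u * h x + ereal v * h y)"

definition lsc_fun :: "('a::topological_space \<Rightarrow> ereal) \<Rightarrow> bool" where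
  "lsc_fun h \<longleftrightarrow> (\<forall>x. h x \<le> Liminf (at x) h)"

definition eps_subdiff :: "real \<Rightarrow> ('a::real_inner \<Rightarrow> ereal) \<Rightarrow> 'a \<Rightarrow> 'a set" where
  "eps_subdiff e h z =
     {p. z \<in> eff_dom h \<and> (\<forall>x. h x \<ge> h z + ereal (p \<bullet> (x - z)) - ereal e)}"

definition pos_def :: "real^'n^'n \<Rightarrow> bool" where
  "pos_def M \<longleftrightarrow> transpose M = M \<and> (\<forall>x. x \<noteq> 0 \<longrightarrow> x \<bullet> (M *v x) > 0)"

definition wnorm_sq :: "real^'n^'n \<Rightarrow> real^'n \<Rightarrow> real" where
  "wnorm_sq D x = x \<bullet> (D *v x)"

(* The value is meaningful unless f x = g y = \<infinity>. *)
definition lagrangian ::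
  "(real^'m \<Rightarrow> ereal) \<Rightarrow> (real^'n \<Rightarrow> ereal) \<Rightarrow> real^'m^'n \<Rightarrow> real^'m \<Rightarrow> real^'n \<Rightarrow> ereal" where
  "lagrangian f g A x y = f x + ereal ((A *v x) \<bullet> y) - g y"

(* Membership of the saddle point in the two domains keeps all values of the Lagrangian that
   are compared here free of the form \<infinity> - \<infinity>. *)
definition saddle_point ::
  "(real^'m \<Rightarrow> ereal) \<Rightarrow> (real^'n \<Rightarrow> ereal) \<Rightarrow> real^'m^'n \<Rightarrow> real^'m \<Rightarrow> real^'n \<Rightarrow> bool" where
  "saddle_point f g A xs ys \<longleftrightarrow>
     xs \<in> eff_dom f \<and> ys \<in> eff_dom g \<and>
     (\<forall>x y. lagrangian f g A xs y \<le> lagrangian f g A xs ys \<and>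
            lagrangian f g A xs ys \<le> lagrangian f g A x ys)"

(* The three clauses are, in order, the type-2 dual step, the type-2 primal step and the type-1
   dual correction step. The starting data are x 0 and yb 0; the values y 0, \<epsilon> 0 and \<delta> 0
   do not occur. *)
definition inexact_pd_seq ::
  "(real^'m \<Rightarrow> ereal) \<Rightarrow> (real^'n \<Rightarrow> ereal) \<Rightarrow> real^'m^'n \<Rightarrow> real^'n^'n \<Rightarrow> real^'n^'n \<Rightarrow>
   (nat \<Rightarrow> real) \<Rightarrow> (nat \<Rightarrow> real) \<Rightarrow> (nat \<Rightarrow> real) \<Rightarrow> (nat \<Rightarrow> real) \<Rightarrow>
   (nat \<Rightarrow> real^'m) \<Rightarrow> (nat \<Rightarrow> real^'n) \<Rightarrow> (nat \<Rightarrow> real^'n) \<Rightarrow> bool" where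
  "inexact_pd_seq f g A R S \<tau> lam \<epsilon> \<delta> x y yb \<longleftrightarrow>
     (\<forall>k.
        (1 / \<tau> k) *\<^sub>R (S *v (yb k - y (Suc k))) + A *v x k
          \<in> eps_subdiff (\<epsilon> (Suc k) / 2) g (y (Suc k)) \<and>
        (1 / lam k) *\<^sub>R ((transpose A ** R ** A) *v (x k - x (Suc k))) - transpose A *v y (Suc k)
          \<in> eps_subdiff (\<delta> (Suc k)) f (x (Suc k)) \<and>
        0 \<in> eps_subdiff (\<epsilon> (Suc k) / 2)
              (\<lambda>v. g v - ereal ((A *v x (Suc k)) \<bullet> v)
                    + ereal (1 / (2 * \<tau> k) * wnorm_sq S (v - yb k)))
              (yb (Suc k)))"

definition average :: "(nat \<Rightarrow> 'a::real_vector) \<Rightarrow> nat \<Rightarrow> 'a" where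
  "average z N = (1 / real N) *\<^sub>R (\<Sum>k<N. z (Suc k))"

definition cluster_point :: "(nat \<Rightarrow> 'a::metric_space) \<Rightarrow> 'a \<Rightarrow> bool" where
  "cluster_point z l \<longleftrightarrow> (\<exists>r::nat \<Rightarrow> nat. strict_mono r \<and> (z \<circ> r) \<longlonglongrightarrow> l)"

end

theory Submission
  imports Defs
begin

text \<open>For a saddle point \<open>(u, v)\<close> put
  \<open>a k = \<parallel>v - yb k\<parallel>\<^sub>S\<^sup>2 / (2 \<tau> k) + \<parallel>A (u - x k)\<parallel>\<^sub>R\<^sup>2 / (2 lam k)\<close>. Adding the three
  inexact optimality conditions, and absorbing the cross term by Young's inequality and the gap
  \<open>R - \<tau>bar lambar S\<^sup>-\<^sup>1 > 0\<close>, shows that \<open>a\<close> decreases up to summable errors and that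
  \<open>x k - x (k + 1)\<close> and \<open>yb k - y (k + 1)\<close> tend to zero. The error of the correction step is of the
  order of \<open>sqrt \<epsilon>\<close> times \<open>sqrt (a (k + 1))\<close>, so it is summable only once \<open>a\<close> is known to be bounded.
  A limit point of \<open>(x k, yb k)\<close> is a saddle point because the graph of the
  \<open>\<epsilon>\<close>-subdifferential is closed; taking it as \<open>(u, v)\<close> forces \<open>a k\<close> to zero, so the iterates
  converge, and the averages converge to the same point.\<close>

section \<open>Quadratic forms of positive definite matrices\<close>

text \<open>The form attains a positive minimum on the compact unit sphere, and homogeneity of
  degree two carries this minimum to all vectors.\<close>

lemma pos_def_coercive:
  fixes D :: "real^'n^'n"
  assumes "pos_def D"
  obtains c where "c > 0" "\<And>x. c * (norm x)\<^sup>2 \<le> wnorm_sq D x"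
proof -
  let ?S = "sphere (0::real^'n) 1"
  have "continuous_on ?S (wnorm_sq D)"
    unfolding wnorm_sq_def by (intro continuous_intros matrix_vector_mult_linear_continuous_on)
  moreover have "?S \<noteq> {}" by simp
  ultimately obtain z where z: "z \<in> ?S" and min: "\<And>x. x \<in> ?S \<Longrightarrow> wnorm_sq D z \<le> wnorm_sq D x"
    using continuous_attains_inf[of ?S "wnorm_sq D"] by (metis compact_sphere)
  have "z \<noteq> 0" using z by auto
  then have pos: "wnorm_sq D z > 0"
    using assms by (simp add: pos_def_def wnorm_sq_def)
  have "wnorm_sq D z * (norm x)\<^sup>2 \<le> wnorm_sq D x" for x
  proof (cases "x = 0")
    case False
    have "wnorm_sq D z \<le> wnorm_sq D ((1 / norm x) *\<^sub>R x)"
      using False by (intro min) simp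
    also have "\<dots> = wnorm_sq D x / (norm x)\<^sup>2"
      by (simp add: wnorm_sq_def matrix_vector_mult_scaleR power2_eq_square)
    finally show ?thesis using False by (simp add: field_simps)
  qed (simp add: wnorm_sq_def)
  with pos show thesis by (rule that)
qed

lemma pos_def_nonneg: "pos_def D \<Longrightarrow> 0 \<le> wnorm_sq D x"
  by (cases "x = 0") (auto simp: pos_def_def wnorm_sq_def less_imp_le)

lemma pos_def_inner_commute: "pos_def D \<Longrightarrow> a \<bullet> (D *v b) = b \<bullet> (D *v a)"
  unfolding pos_def_def by (metis dot_lmul_matrix inner_commute vector_transpose_matrix)

lemma wnorm_sq_diff_commute: "wnorm_sq D (a - b) = wnorm_sq D (b - a)"
  by (simp add: wnorm_sq_def matrix_vector_mult_diff_distrib inner_diff_left inner_diff_right)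

text \<open>Polarisation: it turns the inner product of a proximal inclusion into squared distances,
  which can be telescoped over the iterations.\<close>

lemma wnorm_sq_three_point:
  assumes "pos_def D"
  shows "(D *v (a - b)) \<bullet> (c - b) = (wnorm_sq D (a - b) + wnorm_sq D (c - b) - wnorm_sq D (c - a)) / 2"
  using pos_def_inner_commute[OF assms, of a b] pos_def_inner_commute[OF assms, of a c]
    pos_def_inner_commute[OF assms, of b c]
  by (simp add: wnorm_sq_def matrix_vector_mult_diff_distrib inner_diff_left inner_diff_right
      inner_commute[of "D *v _"] field_simps)

text \<open>The negative last term is the strong convexity of the quadratic, the source of the
  growth in \<open>approx_prox_growth\<close>.\<close>

lemma wnorm_sq_convex_combination:
  assumes "pos_def D"
  shows "wnorm_sq D ((1 - t) *\<^sub>R a + t *\<^sub>R b - c)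
    = (1 - t) * wnorm_sq D (a - c) + t * wnorm_sq D (b - c) - t * (1 - t) * wnorm_sq D (b - a)"
  using pos_def_inner_commute[OF assms, of a b] pos_def_inner_commute[OF assms, of a c]
    pos_def_inner_commute[OF assms, of b c]
  by (simp add: wnorm_sq_def matrix_vector_mult_diff_distrib matrix_vector_right_distrib
      matrix_vector_mult_scaleR inner_diff_left inner_diff_right inner_add_left inner_add_right
      algebra_simps)

lemma pos_def_mult_inv:
  assumes "pos_def D"
  shows "D *v (matrix_inv D *v p) = p"
proof -
  have "D *v z = 0 \<longrightarrow> z = 0" for z
    using assms unfolding pos_def_def by (metis inner_zero_right less_irrefl)
  then have "invertible D"
    by (simp add: invertible_left_inverse matrix_left_invertible_ker)
  \<comment> \<open>\<open>matrix_inv\<close> chooses among the two-sided inverses, so its defining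
    property holds once one exists.\<close>
  then have "D ** matrix_inv D = mat 1"
    unfolding invertible_def matrix_inv_def by (rule someI2_ex) blast
  then show ?thesis
    by (simp add: matrix_vector_mul_assoc)
qed

text \<open>Expand the square \<open>wnorm_sq D (\<tau> *\<^sub>R q - z) \<ge> 0\<close>, where
  \<open>q\<close> is the preimage of \<open>p\<close> under \<open>D\<close>.\<close>

lemma pos_def_young:
  assumes "pos_def D" "\<tau> > 0"
  shows "p \<bullet> z \<le> \<tau> / 2 * wnorm_sq (matrix_inv D) p + 1 / (2 * \<tau>) * wnorm_sq D z"
proof -
  define q where "q = matrix_inv D *v p"
  have p: "p = D *v q" using pos_def_mult_inv[OF assms(1)] by (simp add: q_def)
  have "wnorm_sq (matrix_inv D) p = q \<bullet> p"
    by (simp add: wnorm_sq_def q_def inner_commute)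
  then have q: "wnorm_sq (matrix_inv D) p = q \<bullet> (D *v q)" using p by simp
  have "0 \<le> wnorm_sq D (\<tau> *\<^sub>R q - z)" by (rule pos_def_nonneg[OF assms(1)])
  also have "\<dots> = \<tau>\<^sup>2 * (q \<bullet> (D *v q)) - 2 * \<tau> * (z \<bullet> (D *v q)) + wnorm_sq D z"
    using pos_def_inner_commute[OF assms(1), of q z]
    by (simp add: wnorm_sq_def matrix_vector_mult_diff_distrib matrix_vector_mult_scaleR
        inner_diff_left inner_diff_right power2_eq_square algebra_simps)
  finally have "2 * \<tau> * (p \<bullet> z) \<le> \<tau>\<^sup>2 * wnorm_sq (matrix_inv D) p + wnorm_sq D z"
    unfolding q by (simp add: p inner_commute)
  then show ?thesis using assms(2) by (simp add: field_simps power2_eq_square)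
qed

lemma wnorm_sq_inv_nonneg:
  assumes "pos_def D"
  shows "0 \<le> wnorm_sq (matrix_inv D) p"
  using pos_def_nonneg[OF assms, of "matrix_inv D *v p"] pos_def_mult_inv[OF assms, of p]
  by (simp add: wnorm_sq_def inner_commute)

text \<open>Moves primal distances to the range of \<open>A\<close>, where \<open>R\<close> can be
  compared with the inverse of \<open>S\<close>.\<close>

lemma wnorm_sq_congruence: "wnorm_sq (transpose A ** R ** A) w = wnorm_sq R (A *v w)"
proof -
  have "w \<bullet> (transpose A *v z) = (A *v w) \<bullet> z" for z
    by (metis dot_lmul_matrix inner_commute vector_transpose_matrix transpose_transpose)
  then show ?thesis by (simp add: wnorm_sq_def matrix_vector_mul_assoc[symmetric])
qed

lemma tendsto_wnorm_sq:
  assumes "(z \<longlongrightarrow> l) F"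
  shows "((\<lambda>n. wnorm_sq D (z n)) \<longlongrightarrow> wnorm_sq D l) F"
  unfolding wnorm_sq_def
  by (intro tendsto_inner assms bounded_linear.tendsto[OF matrix_vector_mul_bounded_linear])

section \<open>Approximate subgradients, saddle points and limits\<close>

lemma ereal_real_eff_dom:
  assumes "proper_fun h" "z \<in> eff_dom h"
  shows "ereal (real_of_ereal (h z)) = h z"
  using assms by (cases "h z") (auto simp: proper_fun_def eff_dom_def)

lemma eps_subdiff_real:
  assumes "proper_fun h" "p \<in> eps_subdiff e h z" "w \<in> eff_dom h"
  shows "real_of_ereal (h z) + p \<bullet> (w - z) - e \<le> real_of_ereal (h w)"
proof -
  have "z \<in> eff_dom h" "h z + ereal (p \<bullet> (w - z)) - ereal e \<le> h w"
    using assms by (auto simp: eps_subdiff_def)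
  then have "ereal (real_of_ereal (h z) + p \<bullet> (w - z) - e) \<le> ereal (real_of_ereal (h w))"
    using ereal_real_eff_dom[OF assms(1)] assms(3)
    by (metis ereal_minus(1) plus_ereal.simps(1))
  then show ?thesis by simp
qed

text \<open>Off the domain \<open>h\<close> is infinite and the inequality is trivial, so real
  arithmetic on the domain suffices.\<close>

lemma eps_subdiffI:
  assumes "proper_fun h" "z \<in> eff_dom h"
    and "\<And>w. w \<in> eff_dom h \<Longrightarrow> real_of_ereal (h z) + p \<bullet> (w - z) - e \<le> real_of_ereal (h w)"
  shows "p \<in> eps_subdiff e h z"
proof -
  have "h z + ereal (p \<bullet> (w - z)) - ereal e \<le> h w" for w
  proof (cases "w \<in> eff_dom h")
    case True
    then have "ereal (real_of_ereal (h z) + p \<bullet> (w - z) - e) \<le> ereal (real_of_ereal (h w))"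
      using assms(3) by simp
    then show ?thesis
      using ereal_real_eff_dom[OF assms(1)] assms(2) True
      by (metis ereal_minus(1) plus_ereal.simps(1))
  qed (simp add: eff_dom_def)
  then show ?thesis using assms(2) by (simp add: eps_subdiff_def)
qed

text \<open>With one variable fixed, the Lagrangian is, up to a constant, \<open>f\<close> or
  \<open>-g\<close> plus a linear term. Each saddle inequality is therefore the exact optimality
  condition in one variable.\<close>

lemma saddle_point_iff_subdiff:
  assumes "proper_fun f" "proper_fun g"
  shows "saddle_point f g A u v \<longleftrightarrow>
    - (transpose A *v v) \<in> eps_subdiff 0 f u \<and> A *v u \<in> eps_subdiff 0 g v"
    (is "?L \<longleftrightarrow> ?R")
proof -
  have adj: "(b v* A) \<bullet> a = (A *v a) \<bullet> b" for a b
    by (metis dot_lmul_matrix inner_commute)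
  note fin = ereal_real_eff_dom[OF assms(1)] ereal_real_eff_dom[OF assms(2)]
  have lag: "lagrangian f g A a b
      = ereal (real_of_ereal (f a) + (A *v a) \<bullet> b - real_of_ereal (g b))"
    if "a \<in> eff_dom f" "b \<in> eff_dom g" for a b
    using fin(1)[OF that(1)] fin(2)[OF that(2)] unfolding lagrangian_def
    by (metis ereal_minus(1) plus_ereal.simps(1))
  show ?thesis
  proof
    assume L: ?L
    then have uv: "u \<in> eff_dom f" "v \<in> eff_dom g" by (auto simp: saddle_point_def)
    show ?R
    proof
      show "- (transpose A *v v) \<in> eps_subdiff 0 f u"
      proof (rule eps_subdiffI[OF assms(1) uv(1)])
        fix w assume w: "w \<in> eff_dom f"
        have "lagrangian f g A u v \<le> lagrangian f g A w v"
          using L by (auto simp: saddle_point_def)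
        then show "real_of_ereal (f u) + - (transpose A *v v) \<bullet> (w - u) - 0 \<le> real_of_ereal (f w)"
          using uv w by (simp add: lag inner_diff_right adj)
      qed
      show "A *v u \<in> eps_subdiff 0 g v"
      proof (rule eps_subdiffI[OF assms(2) uv(2)])
        fix w assume w: "w \<in> eff_dom g"
        have "lagrangian f g A u w \<le> lagrangian f g A u v"
          using L by (auto simp: saddle_point_def)
        then show "real_of_ereal (g v) + (A *v u) \<bullet> (w - v) - 0 \<le> real_of_ereal (g w)"
          using uv w by (simp add: lag inner_diff_right)
      qed
    qed
  next
    assume R: ?R
    then have uv: "u \<in> eff_dom f" "v \<in> eff_dom g" by (auto simp: eps_subdiff_def)
    have "lagrangian f g A u b \<le> lagrangian f g A u v" for b
    proof (cases "b \<in> eff_dom g")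
      case True
      then show ?thesis
        using uv eps_subdiff_real[OF assms(2), of "A *v u" 0 v b] R
        by (simp add: lag inner_diff_right)
    next
      case False
      \<comment> \<open>\<open>f u\<close> is finite, so an infinite \<open>g b\<close> really gives
        minus infinity and not a difference of infinities.\<close>
      then have "lagrangian f g A u b = -\<infinity>"
        using fin(1)[OF uv(1)] unfolding lagrangian_def eff_dom_def
        by (cases "f u") auto
      then show ?thesis by simp
    qed
    moreover have "lagrangian f g A u v \<le> lagrangian f g A a v" for a
    proof (cases "a \<in> eff_dom f")
      case True
      then show ?thesis
        using uv eps_subdiff_real[OF assms(1), of "- (transpose A *v v)" 0 u a] R
        by (simp add: lag inner_diff_right adj)
    next
      case False
      then have "lagrangian f g A a v = \<infinity>"
        using fin(2)[OF uv(2)] unfolding lagrangian_def eff_dom_def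
        by (cases "g v") auto
      then show ?thesis by simp
    qed
    ultimately show ?L using uv by (simp add: saddle_point_def)
  qed
qed

text \<open>Otherwise some \<open>d\<close> lies strictly between \<open>c'\<close> and
  \<open>h l\<close>. By semicontinuity \<open>h\<close> exceeds \<open>d\<close> near
  \<open>l\<close>, while the bounds \<open>c n\<close> eventually drop below
  \<open>d\<close>.\<close>

lemma lsc_fun_limit_le:
  fixes X :: "nat \<Rightarrow> 'a::topological_space"
  assumes "lsc_fun h" "X \<longlonglongrightarrow> l" "\<And>n. h (X n) \<le> ereal (c n)" "c \<longlonglongrightarrow> c'"
  shows "h l \<le> ereal c'"
proof (rule ccontr)
  assume "\<not> h l \<le> ereal c'"
  then obtain d where d: "ereal c' < ereal d" "ereal d < h l"
    using ereal_dense2 not_le by metis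
  have "ereal d < Liminf (at l) h"
    using d(2) assms(1) unfolding lsc_fun_def by (meson less_le_trans)
  then have "eventually (\<lambda>z. ereal d < h z) (at l)"
    by (rule less_LiminfD)
  \<comment> \<open>\<open>at l\<close> is a punctured filter, but \<open>X n\<close> may equal
    \<open>l\<close>; the value at \<open>l\<close> itself is added here.\<close>
  then have "eventually (\<lambda>z. ereal d < h z) (nhds l)"
    using d(2) by (auto simp: eventually_at_filter elim: eventually_mono)
  then have "eventually (\<lambda>n. ereal d < h (X n)) sequentially"
    using assms(2) by (auto simp: filterlim_iff)
  moreover have "eventually (\<lambda>n. c n < d) sequentially"
    using assms(4) d(1) by (auto intro: order_tendstoD)
  ultimately have "eventually (\<lambda>n. False) sequentially"
  proof eventually_elim
    case (elim n)
    have "ereal d < ereal (c n)" using elim(1) assms(3) less_le_trans by blast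
    then show ?case using elim(2) by simp
  qed
  then show False by simp
qed

text \<open>Solved for \<open>h (z n)\<close>, the subgradient inequality is an upper bound that
  converges for every fixed \<open>w\<close>; lower semicontinuity transfers it to
  \<open>z'\<close>.\<close>

lemma eps_subdiff_closed:
  fixes p z :: "nat \<Rightarrow> 'a::real_inner"
  assumes "proper_fun h" "lsc_fun h"
    and sub: "\<And>n. p n \<in> eps_subdiff (e n) h (z n)"
    and "p \<longlonglongrightarrow> p'" "z \<longlonglongrightarrow> z'" "e \<longlonglongrightarrow> e'"
  shows "p' \<in> eps_subdiff e' h z'"
proof -
  have zn: "z n \<in> eff_dom h" for n using sub[of n] by (simp add: eps_subdiff_def)
  have *: "h z' \<le> ereal (real_of_ereal (h w) - p' \<bullet> (w - z') + e')" if w: "w \<in> eff_dom h" for w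
  proof (rule lsc_fun_limit_le[OF assms(2,5)])
    fix n
    have "real_of_ereal (h (z n)) \<le> real_of_ereal (h w) - p n \<bullet> (w - z n) + e n"
      using eps_subdiff_real[OF assms(1) sub w, of n] by simp
    then show "h (z n) \<le> ereal (real_of_ereal (h w) - p n \<bullet> (w - z n) + e n)"
      using ereal_real_eff_dom[OF assms(1) zn, of n] by (metis ereal_less_eq(3))
    show "(\<lambda>n. real_of_ereal (h w) - p n \<bullet> (w - z n) + e n) \<longlonglongrightarrow> real_of_ereal (h w) - p' \<bullet> (w - z') + e'"
      by (intro tendsto_intros assms)
  qed
  \<comment> \<open>One finite bound already puts \<open>z'\<close> into the domain.\<close>
  obtain w where "w \<in> eff_dom h" using assms(1) by (auto simp: proper_fun_def)
  from *[OF this] have z': "z' \<in> eff_dom h" by (auto simp: eff_dom_def less_top[symmetric] top_ereal_def)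
  show ?thesis
  proof (rule eps_subdiffI[OF assms(1) z'])
    fix w assume "w \<in> eff_dom h"
    from *[OF this] show "real_of_ereal (h z') + p' \<bullet> (w - z') - e' \<le> real_of_ereal (h w)"
      using ereal_real_eff_dom[OF assms(1) z'] ereal_less_eq(3)[of "real_of_ereal (h z')"]
      by (simp add: algebra_simps)
  qed
qed

section \<open>The energy estimate for a single inexact iteration\<close>

text \<open>Minimises \<open>t * Q + e / (2 * t)\<close> over \<open>t\<close>: the minimiser is
  \<open>sqrt (e / (2 * Q))\<close> and the minimum \<open>sqrt (2 * e * Q)\<close>. If
  \<open>2 * Q \<le> e\<close> it is not below 1, and \<open>t = 1\<close> is taken at the price of
  the summand \<open>e\<close>.\<close>

lemma sqrt_interpolation:
  fixes D Q e :: real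
  assumes "0 \<le> Q" "0 \<le> e" and step: "\<And>t. 0 < t \<Longrightarrow> t \<le> 1 \<Longrightarrow> D \<le> t * Q - Q + e / (2 * t)"
  shows "D \<le> sqrt (2 * e * Q) - Q + e"
proof (cases "2 * Q \<le> e")
  case True
  then show ?thesis using step[of 1] assms
    by (smt (verit) real_sqrt_ge_zero mult_nonneg_nonneg field_sum_of_halves mult_1 mult.right_neutral)
next
  case False
  show ?thesis
  proof (cases "e = 0")
    case True
    \<comment> \<open>For \<open>e = 0\<close> the minimiser would be the excluded value 0, so
      \<open>t\<close> tends to 0 from the right instead.\<close>
    have "((\<lambda>t. t * Q - Q) \<longlongrightarrow> 0 * Q - Q) (at_right (0::real))"
      by (intro tendsto_intros)
    moreover have "eventually (\<lambda>t. D \<le> t * Q - Q) (at_right (0::real))"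
      unfolding eventually_at_right_field using step True by (intro exI[of _ 1]) auto
    ultimately have "D \<le> 0 * Q - Q" by (intro tendsto_lowerbound) auto
    then show ?thesis using True by simp
  next
    case e: False
    define t where "t = sqrt (e / (2 * Q))"
    have pos: "0 < e" "0 < Q" using e False assms by auto
    have t: "0 < t" "t \<le> 1" "t\<^sup>2 = e / (2 * Q)"
      using pos False by (auto simp: t_def)
    have "t * Q = sqrt ((t * Q)\<^sup>2)" using t(1) pos by simp
    also have "\<dots> = sqrt (e * Q / 2)"
      using pos unfolding power_mult_distrib t(3) by (simp add: power2_eq_square)
    finally have tQ: "t * Q = sqrt (e * Q / 2)" .
    have e2: "e / (2 * t) = t * Q" using t pos by (simp add: field_simps power2_eq_square)
    have "sqrt (2 * e * Q) = sqrt (2\<^sup>2 * (e * Q / 2))" by (simp add: power2_eq_square)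
    also have "\<dots> = 2 * sqrt (e * Q / 2)" unfolding real_sqrt_mult by simp
    finally show ?thesis using step[OF t(1,2)] e2 tQ pos by linarith
  qed
qed

text \<open>Comparing with points on the segment from the approximate minimiser to \<open>v\<close> recovers the
  quadratic growth of strong convexity, up to an error of order \<open>sqrt e\<close>.\<close>

lemma approx_prox_growth:
  fixes g :: "real^'n \<Rightarrow> ereal"
  assumes "proper_fun g" "convex_fun g" "pos_def S" "\<tau> > 0" "e \<ge> 0"
    and opt: "0 \<in> eps_subdiff (e / 2)
              (\<lambda>v. g v - ereal (q \<bullet> v) + ereal (1 / (2 * \<tau>) * wnorm_sq S (v - c))) b"
    and v: "v \<in> eff_dom g"
  defines "Q \<equiv> 1 / (2 * \<tau>) * wnorm_sq S (v - b)"
  shows "b \<in> eff_dom g"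
    and "real_of_ereal (g b) - q \<bullet> b + 1 / (2 * \<tau>) * wnorm_sq S (b - c) + Q
      \<le> real_of_ereal (g v) - q \<bullet> v + 1 / (2 * \<tau>) * wnorm_sq S (v - c) + sqrt (2 * e * Q) + e"
proof -
  define G where "G = (\<lambda>v. g v - ereal (q \<bullet> v) + ereal (1 / (2 * \<tau>) * wnorm_sq S (v - c)))"
  define r where "r w = real_of_ereal (g w)" for w
  define h where "h w = r w - q \<bullet> w + 1 / (2 * \<tau>) * wnorm_sq S (w - c)" for w
  have dom: "eff_dom G = eff_dom g"
  proof -
    have "G w < \<infinity> \<longleftrightarrow> g w < \<infinity>" for w by (cases "g w") (auto simp: G_def)
    then show ?thesis by (simp add: eff_dom_def)
  qed
  have fin: "g w = ereal (r w)" if "w \<in> eff_dom g" for w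
    using ereal_real_eff_dom[OF assms(1) that] by (simp add: r_def)
  have G: "G w = ereal (h w)" if "w \<in> eff_dom g" for w
    using fin[OF that] by (simp add: G_def h_def)
  have properG: "proper_fun G"
  proof -
    have "G w \<noteq> -\<infinity>" for w
      using assms(1) by (cases "g w") (auto simp: G_def proper_fun_def)
    then show ?thesis using v by (auto simp: proper_fun_def dom)
  qed
  have opt': "0 \<in> eps_subdiff (e / 2) G b" using opt by (simp add: G_def)
  then show b: "b \<in> eff_dom g" by (auto simp: eps_subdiff_def dom)
  have min: "h b \<le> h w + e / 2" if "w \<in> eff_dom g" for w
    using eps_subdiff_real[OF properG opt', of w] that b by (simp add: dom G)
  have "h b - h v \<le> t * Q - Q + e / (2 * t)" if t: "0 < t" "t \<le> 1" for t
  proof -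
    define z where "z = (1 - t) *\<^sub>R b + t *\<^sub>R v"
    have "g z \<le> ereal (1 - t) * g b + ereal t * g v"
      using assms(2) t unfolding convex_fun_def z_def by auto
    also have "\<dots> = ereal ((1 - t) * r b + t * r v)" using fin b v by simp
    finally have gz: "g z \<le> ereal ((1 - t) * r b + t * r v)" .
    then have z: "z \<in> eff_dom g" by (auto simp: eff_dom_def less_top[symmetric] top_ereal_def)
    have "r z \<le> (1 - t) * r b + t * r v" using gz fin[OF z] by simp
    moreover have "q \<bullet> z = (1 - t) * (q \<bullet> b) + t * (q \<bullet> v)"
      by (simp add: z_def inner_add_right)
    moreover have "1 / (2 * \<tau>) * wnorm_sq S (z - c) = (1 - t) * (1 / (2 * \<tau>) * wnorm_sq S (b - c))
        + t * (1 / (2 * \<tau>) * wnorm_sq S (v - c)) - t * (1 - t) * Q"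
      unfolding z_def Q_def wnorm_sq_convex_combination[OF assms(3)]
      by (simp add: algebra_simps add_divide_distrib diff_divide_distrib)
    ultimately have "h z \<le> (1 - t) * h b + t * h v - t * (1 - t) * Q"
      unfolding h_def by (simp add: algebra_simps)
    then have "t * (h b - h v) \<le> t * (t * Q - Q) + e / 2"
      using min[OF z] by (simp add: algebra_simps)
    \<comment> \<open>Division by \<open>t\<close> inflates the tolerance to
      \<open>e / (2 * t)\<close>; this is why \<open>t\<close> has to be balanced against
      \<open>e\<close>.\<close>
    then have "h b - h v \<le> (t * (t * Q - Q) + e / 2) / t" using t by (simp add: field_simps)
    also have "\<dots> = t * Q - Q + e / (2 * t)" using t by (simp add: field_simps)
    finally show ?thesis .
  qed
  moreover have "0 \<le> Q" using pos_def_nonneg[OF assms(3)] assms(4) by (simp add: Q_def)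
  ultimately have "h b - h v \<le> sqrt (2 * e * Q) - Q + e"
    using assms(5) by (intro sqrt_interpolation)
  then show "real_of_ereal (g b) - q \<bullet> b + 1 / (2 * \<tau>) * wnorm_sq S (b - c) + Q
      \<le> real_of_ereal (g v) - q \<bullet> v + 1 / (2 * \<tau>) * wnorm_sq S (v - c) + sqrt (2 * e * Q) + e"
    by (simp add: h_def r_def)
qed

text \<open>Each condition is tested at a point that makes the sum collapse: the saddle inclusions
  at \<open>x'\<close> and \<open>y'\<close>, the primal step at \<open>u\<close>, the dual step at
  \<open>yb'\<close>, the correction at \<open>v\<close>. Only the coupling of \<open>x' - x\<close>
  with \<open>yb' - y'\<close> survives, and Young's inequality with weight \<open>\<tau>\<close>
  pays for its dual half exactly. The errors \<open>d\<close>, \<open>e / 2\<close> and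
  \<open>e\<close> add up.\<close>

lemma inexact_step_descent:
  fixes f :: "real^'m \<Rightarrow> ereal" and g :: "real^'n \<Rightarrow> ereal" and A :: "real^'m^'n"
  assumes f: "proper_fun f" and g: "proper_fun g" "convex_fun g"
    and S: "pos_def S" and M: "pos_def M" and "\<tau> > 0" "lam > 0" "e \<ge> 0"
    and dual: "(1 / \<tau>) *\<^sub>R (S *v (yb - y')) + A *v x \<in> eps_subdiff (e / 2) g y'"
    and primal: "(1 / lam) *\<^sub>R (M *v (x - x')) - transpose A *v y' \<in> eps_subdiff d f x'"
    and corr: "0 \<in> eps_subdiff (e / 2)
        (\<lambda>v. g v - ereal ((A *v x') \<bullet> v) + ereal (1 / (2 * \<tau>) * wnorm_sq S (v - yb))) yb'"
    and saddle: "saddle_point f g A u v"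
  defines "Q \<equiv> 1 / (2 * \<tau>) * wnorm_sq S (v - yb')"
  shows "Q + 1 / (2 * lam) * wnorm_sq M (u - x')
      + (1 / (2 * lam) * wnorm_sq M (x - x') - \<tau> / 2 * wnorm_sq (matrix_inv S) (A *v (x - x')))
      + 1 / (2 * \<tau>) * wnorm_sq S (yb - y')
    \<le> 1 / (2 * \<tau>) * wnorm_sq S (v - yb) + 1 / (2 * lam) * wnorm_sq M (u - x)
      + (d + 3 / 2 * e) + sqrt (2 * e * Q)"
proof -
  have adj: "(b v* A) \<bullet> a = (A *v a) \<bullet> b" for a b
    by (metis dot_lmul_matrix inner_commute)
  define F where "F w = real_of_ereal (f w)" for w
  define G where "G w = real_of_ereal (g w)" for w
  have sad: "- (transpose A *v v) \<in> eps_subdiff 0 f u" "A *v u \<in> eps_subdiff 0 g v"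
    using saddle saddle_point_iff_subdiff[OF f g(1)] by auto
  have doms: "u \<in> eff_dom f" "v \<in> eff_dom g" "x' \<in> eff_dom f" "y' \<in> eff_dom g"
    using sad dual primal by (auto simp: eps_subdiff_def)
  note growth = approx_prox_growth[OF g S \<open>\<tau> > 0\<close> \<open>e \<ge> 0\<close> corr doms(2), folded Q_def G_def]
  have 1: "F u - (A *v (x' - u)) \<bullet> v \<le> F x'"
    using eps_subdiff_real[OF f sad(1) doms(3)] by (simp add: adj F_def)
  have 2: "G v + (A *v u) \<bullet> (y' - v) \<le> G y'"
    using eps_subdiff_real[OF g(1) sad(2) doms(4)] by (simp add: G_def)
  have 3: "F x' + 1 / (2 * lam) * (wnorm_sq M (x - x') + wnorm_sq M (u - x') - wnorm_sq M (u - x))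
      - (A *v (u - x')) \<bullet> y' - d \<le> F u"
    using eps_subdiff_real[OF f primal doms(1)] wnorm_sq_three_point[OF M, of x x' u]
    by (simp add: adj F_def inner_diff_left)
  have 4: "G y' + 1 / (2 * \<tau>) * (wnorm_sq S (yb - y') + wnorm_sq S (yb' - y') - wnorm_sq S (yb' - yb))
      + (A *v x) \<bullet> (yb' - y') - e / 2 \<le> G yb'"
    using eps_subdiff_real[OF g(1) dual growth(1)] wnorm_sq_three_point[OF S, of yb y' yb']
    by (simp add: G_def inner_add_left)
  have 5: "(A *v (x' - x)) \<bullet> (yb' - y')
      \<le> \<tau> / 2 * wnorm_sq (matrix_inv S) (A *v (x - x')) + 1 / (2 * \<tau>) * wnorm_sq S (yb' - y')"
    using pos_def_young[OF S \<open>\<tau> > 0\<close>, of "A *v (x' - x)" "yb' - y'"]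
    by (simp add: matrix_vector_mult_diff_distrib wnorm_sq_diff_commute)
  show ?thesis
    using 1 2 3 4 5 growth(2)
    by (simp add: matrix_vector_mult_diff_distrib inner_diff_left inner_diff_right ring_distribs)
qed

section \<open>Almost decreasing real sequences\<close>

text \<open>If \<open>b n\<close> were the first term above the bound, it would dominate all earlier
  ones, so its square would be at most \<open>C + K * b n\<close>. The summand 1 makes
  \<open>b n > 1\<close>, hence \<open>C \<le> C * b n\<close>, and dividing by \<open>b n\<close>
  is contradictory.\<close>

lemma sqrt_recursion_bound:
  fixes b s :: "nat \<Rightarrow> real"
  assumes rec: "\<And>n. (b n)\<^sup>2 \<le> C + (\<Sum>k\<le>n. s k * b k)"
    and s: "\<And>k. 0 \<le> s k" and sum: "\<And>n. (\<Sum>k\<le>n. s k) \<le> K" and "0 \<le> C"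
  shows "b n \<le> 1 + C + K"
proof (induction n rule: less_induct)
  case (less n)
  show ?case
  proof (rule ccontr)
    assume "\<not> b n \<le> 1 + C + K"
    then have n: "1 + C + K < b n" by simp
    have K: "0 \<le> K" using sum[of 0] s[of 0] by simp
    have "(\<Sum>k\<le>n. s k * b k) \<le> (\<Sum>k\<le>n. s k * b n)"
    proof (intro sum_mono mult_left_mono s)
      fix k assume "k \<in> {..n}"
      then show "b k \<le> b n" using less[of k] n by (cases "k = n") auto
    qed
    also have "\<dots> \<le> K * b n"
      using sum[of n] n K assms(4) by (simp add: sum_distrib_right[symmetric] mult_right_mono)
    finally have "(b n)\<^sup>2 \<le> C + K * b n" using rec[of n] by simp
    also have "\<dots> \<le> C * b n + K * b n"
      using n K assms(4) by (simp add: mult_le_cancel_left1)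
    also have "\<dots> = (C + K) * b n" by (simp add: algebra_simps)
    finally have "b n \<le> C + K"
      using n K assms(4) by (simp add: power2_eq_square)
    then show False using n by simp
  qed
qed

text \<open>A bootstrap: summing the recursion first bounds \<open>sqrt (a' k)\<close>, after which
  the error \<open>s k * sqrt (a' k)\<close> is summable. \<open>a'\<close> is kept apart from the
  shifted \<open>a\<close> because the new iterates are first measured with the old step
  sizes.\<close>

lemma quasi_fejer_sqrt:
  fixes a a' P \<eta> s :: "nat \<Rightarrow> real"
  assumes nonneg: "\<And>k. 0 \<le> a k" "\<And>k. 0 \<le> P k" "\<And>k. 0 \<le> \<eta> k" "\<And>k. 0 \<le> s k"
    and mono: "\<And>k. a (Suc k) \<le> a' k"
    and rec: "\<And>k. a' k + P k \<le> a k + \<eta> k + s k * sqrt (a' k)"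
    and "summable \<eta>" "summable s"
  obtains \<sigma> where "summable \<sigma>" "\<And>k. 0 \<le> \<sigma> k" "\<And>k. a (Suc k) + P k \<le> a k + \<sigma> k"
proof -
  have a': "0 \<le> a' k" for k using nonneg(1)[of "Suc k"] mono[of k] by simp
  have a'_le: "a' n \<le> a 0 + (\<Sum>k\<le>n. \<eta> k) + (\<Sum>k\<le>n. s k * sqrt (a' k))" for n
  proof (induction n)
    case 0
    then show ?case using rec[of 0] nonneg(2)[of 0] by simp
  next
    case (Suc n)
    then show ?case using rec[of "Suc n"] nonneg(2)[of "Suc n"] mono[of n] by simp
  qed
  have "(sqrt (a' n))\<^sup>2 \<le> (a 0 + suminf \<eta>) + (\<Sum>k\<le>n. s k * sqrt (a' k))" for n
  proof -
    have "(\<Sum>k\<le>n. \<eta> k) \<le> suminf \<eta>"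
      using assms by (intro sum_le_suminf) auto
    then show ?thesis
      using a'_le[of n] real_sqrt_pow2[OF a'[of n]] by linarith
  qed
  moreover have "(\<Sum>k\<le>n. s k) \<le> suminf s" for n
    using assms by (intro sum_le_suminf) auto
  moreover have "0 \<le> a 0 + suminf \<eta>"
    using nonneg(1) suminf_nonneg[OF \<open>summable \<eta>\<close> nonneg(3)] by simp
  ultimately have bound: "sqrt (a' n) \<le> 1 + (a 0 + suminf \<eta>) + suminf s" for n
    using sqrt_recursion_bound[where b = "\<lambda>n. sqrt (a' n)" and s = s] nonneg(4) by blast
  define B where "B = 1 + (a 0 + suminf \<eta>) + suminf s"
  have B: "0 \<le> B" using bound[of 0] a'[of 0] unfolding B_def by (meson order_trans real_sqrt_ge_zero)
  show thesis
  proof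
    show "summable (\<lambda>k. \<eta> k + s k * B)"
      using assms by (intro summable_add summable_mult2)
    fix k
    show "0 \<le> \<eta> k + s k * B" using nonneg B by simp
    have "s k * sqrt (a' k) \<le> s k * B" using bound nonneg by (simp add: B_def mult_left_mono)
    then show "a (Suc k) + P k \<le> a k + (\<eta> k + s k * B)"
      using rec[of k] mono[of k] by simp
  qed
qed

text \<open>The free starting index \<open>m\<close> allows the use of tails of the error
  series.\<close>

lemma quasi_fejer_telescope:
  fixes a P \<sigma> :: "nat \<Rightarrow> real"
  assumes "\<And>k. a (Suc k) + P k \<le> a k + \<sigma> k"
  shows "a (m + j) + (\<Sum>k<j. P (m + k)) \<le> a m + (\<Sum>k<j. \<sigma> (m + k))"
proof (induction j)
  case (Suc j)
  then show ?case using assms[of "m + j"] by simp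
qed simp

lemma quasi_fejer:
  fixes a P \<sigma> :: "nat \<Rightarrow> real"
  assumes nonneg: "\<And>k. 0 \<le> a k" "\<And>k. 0 \<le> P k" "\<And>k. 0 \<le> \<sigma> k"
    and rec: "\<And>k. a (Suc k) + P k \<le> a k + \<sigma> k" and sum: "summable \<sigma>"
  shows "a n \<le> a 0 + suminf \<sigma>"
    and "P \<longlonglongrightarrow> 0"
    and "strict_mono r \<Longrightarrow> (a \<circ> r) \<longlonglongrightarrow> 0 \<Longrightarrow> a \<longlonglongrightarrow> 0"
proof -
  note tel = quasi_fejer_telescope[of a P \<sigma>, OF rec]
  have le: "(\<Sum>k<n. \<sigma> k) \<le> suminf \<sigma>" for n
    using sum nonneg by (intro sum_le_suminf) auto
  show "a n \<le> a 0 + suminf \<sigma>"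
    using tel[of 0 n] le[of n] sum_nonneg[of "{..<n}" P] nonneg(2) by simp
  have "summable P"
  proof (rule bounded_imp_summable)
    show "(\<Sum>k\<le>n. P k) \<le> a 0 + suminf \<sigma>" for n
      using tel[of 0 "Suc n"] le[of "Suc n"] nonneg(1)[of "Suc n"]
      by (simp add: lessThan_Suc_atMost)
  qed (rule nonneg)
  then show "P \<longlonglongrightarrow> 0" by (rule summable_LIMSEQ_zero)
  assume r: "strict_mono r" "(a \<circ> r) \<longlonglongrightarrow> 0"
  show "a \<longlonglongrightarrow> 0"
  proof (rule LIMSEQ_I)
    fix e :: real assume e: "e > 0"
    obtain N where N: "\<And>m n. m \<ge> N \<Longrightarrow> norm (sum \<sigma> {m..<n}) < e / 2"
      using sum e unfolding summable_Cauchy by (meson half_gt_zero)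
    obtain i where i: "\<And>j. j \<ge> i \<Longrightarrow> norm (a (r j)) < e / 2"
      using LIMSEQ_D[OF r(2), of "e / 2"] e by auto
    \<comment> \<open>At \<open>m\<close> both the value of \<open>a\<close> and all later error
      sums are below \<open>e / 2\<close>, so \<open>a\<close> can never climb back to
      \<open>e\<close>.\<close>
    define m where "m = r (max i N)"
    have m: "m \<ge> N" "a m < e / 2"
      using seq_suble[OF r(1), of "max i N"] i[of "max i N"] by (auto simp: m_def)
    have "norm (a n - 0) < e" if n: "n \<ge> m" for n
    proof -
      obtain j where j: "n = m + j" using n le_Suc_ex by blast
      have "sum \<sigma> {m..<m+j} = (\<Sum>k<j. \<sigma> (m + k))"
        using sum.shift_bounds_nat_ivl[of \<sigma> 0 m j]
        by (simp add: atLeast0LessThan add.commute)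
      then have "(\<Sum>k<j. \<sigma> (m + k)) < e / 2" using N[OF m(1), of "m + j"] by simp
      moreover have "0 \<le> (\<Sum>k<j. P (m + k))" using nonneg(2) by (intro sum_nonneg)
      ultimately show ?thesis using tel[of m j] m(2) nonneg(1)[of n] by (simp add: j)
    qed
    then show "\<exists>no. \<forall>n\<ge>no. norm (a n - 0) < e" by blast
  qed
qed

section \<open>Averages, convergence in weighted norms, and parameter bounds\<close>

text \<open>Cesaro's theorem: a fixed initial sum is divided by \<open>n\<close>, and the remaining
  terms are uniformly small.\<close>

lemma average_tendsto:
  fixes z :: "nat \<Rightarrow> 'a::real_normed_vector"
  assumes "z \<longlonglongrightarrow> l"
  shows "average z \<longlonglongrightarrow> l"
proof (rule LIMSEQ_I)
  fix e :: real assume e: "e > 0"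
  have "(\<lambda>k. z (Suc k)) \<longlonglongrightarrow> l" using assms by (rule LIMSEQ_Suc)
  then obtain N where N: "\<And>k. k \<ge> N \<Longrightarrow> norm (z (Suc k) - l) < e / 2"
    using LIMSEQ_D[of "\<lambda>k. z (Suc k)" l "e / 2"] e by auto
  define C where "C = (\<Sum>k<N. norm (z (Suc k) - l))"
  \<comment> \<open>\<open>n0\<close> makes the initial sum \<open>C\<close> smaller than
    \<open>n * e / 2\<close>; the \<open>Suc N\<close> in the threshold below keeps \<open>n\<close>
    positive.\<close>
  obtain n0 :: nat where n0: "2 * C / e < real n0" using reals_Archimedean2 by blast
  have "norm (average z n - l) < e" if n: "n \<ge> max (Suc N) n0" for n
  proof -
    have n': "n > 0" "N \<le> n" "2 * C < real n * e" using n n0 e by (auto simp: field_simps)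
      (smt (verit) mult_left_mono of_nat_mono)
    have "average z n - l = (1 / real n) *\<^sub>R (\<Sum>k<n. z (Suc k) - l)"
      using n' by (simp add: average_def sum_subtractf scaleR_diff_right sum_constant_scaleR)
    then have "real n * norm (average z n - l) = norm (\<Sum>k<n. z (Suc k) - l)"
      using n' by simp
    also have "\<dots> \<le> (\<Sum>k<n. norm (z (Suc k) - l))" by (rule norm_sum)
    also have "\<dots> = C + (\<Sum>k=N..<n. norm (z (Suc k) - l))"
      using sum.atLeastLessThan_concat[of 0 N n "\<lambda>k. norm (z (Suc k) - l)"] n'
      by (simp add: C_def atLeast0LessThan)
    also have "\<dots> \<le> C + (\<Sum>k=N..<n. e / 2)"
      using N by (intro add_left_mono sum_mono less_imp_le) auto
    also have "\<dots> \<le> C + real n * (e / 2)" using n' e by (simp add: mult_right_mono)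
    also have "\<dots> < real n * e" using n' by simp
    finally show ?thesis using n' by simp
  qed
  then show "\<exists>no. \<forall>n\<ge>no. norm (average z n - l) < e" by blast
qed

lemma tendsto_zero_dominated:
  fixes h p :: "nat \<Rightarrow> real"
  assumes "p \<longlonglongrightarrow> 0" "\<And>n. 0 \<le> h n" "\<And>n. h n \<le> C * p n"
  shows "h \<longlonglongrightarrow> 0"
proof (rule tendsto_sandwich[OF _ _ tendsto_const])
  show "(\<lambda>n. C * p n) \<longlonglongrightarrow> 0" using tendsto_mult_right_zero[OF assms(1)] .
qed (use assms in auto)

lemma pos_def_tendsto_zero:
  assumes "pos_def D" "(\<lambda>n. wnorm_sq D (z n)) \<longlonglongrightarrow> 0"
  shows "z \<longlonglongrightarrow> 0"
proof -
  obtain c where c: "c > 0" "\<And>w. c * (norm w)\<^sup>2 \<le> wnorm_sq D w"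
    using pos_def_coercive[OF assms(1)] by blast
  have "(norm (z n))\<^sup>2 \<le> 1 / c * wnorm_sq D (z n)" for n
    using c by (simp add: field_simps)
  then have "(\<lambda>n. (norm (z n))\<^sup>2) \<longlonglongrightarrow> 0"
    by (rule tendsto_zero_dominated[OF assms(2) zero_le_power2])
  then show ?thesis by (simp add: power_tendsto_0_iff tendsto_norm_zero_iff)
qed

lemma pos_def_bounded_range:
  assumes "pos_def D" "\<And>n. wnorm_sq D (u - z n) \<le> B"
  shows "bounded (range z)"
proof -
  obtain c where c: "c > 0" "\<And>w. c * (norm w)\<^sup>2 \<le> wnorm_sq D w"
    using pos_def_coercive[OF assms(1)] by blast
  have "dist u (z n) \<le> sqrt (B / c)" for n
  proof -
    have "(dist u (z n))\<^sup>2 \<le> B / c"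
      using c(2)[of "u - z n"] assms(2)[of n] c(1) by (simp add: dist_norm field_simps)
    then show ?thesis by (simp add: real_le_rsqrt)
  qed
  then show ?thesis unfolding bounded_def by blast
qed

text \<open>The form of the inverse of \<open>S\<close> is nonnegative, so passing from
  \<open>\<tau> * lam\<close> to the limiting product only shrinks the gap. One constant
  \<open>c\<close> thus serves all iterations, after division by \<open>2 * lam\<close>.\<close>

lemma proximal_gap_bound:
  assumes S: "pos_def S" and gap: "\<And>z. c * (norm z)\<^sup>2 \<le> wnorm_sq (R - (\<tau>bar * lambar) *\<^sub>R matrix_inv S) z"
    and "c \<ge> 0" "0 < \<tau>" "\<tau> \<le> \<tau>bar" "0 < lam" "lam \<le> lambar"
  shows "c / (2 * lambar) * (norm z)\<^sup>2 \<le> 1 / (2 * lam) * wnorm_sq R z - \<tau> / 2 * wnorm_sq (matrix_inv S) z"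
proof -
  have "c * (norm z)\<^sup>2 \<le> wnorm_sq R z - \<tau>bar * lambar * wnorm_sq (matrix_inv S) z"
    using gap[of z] by (simp add: wnorm_sq_def matrix_vector_mult_diff_rdistrib inner_diff_right
        scaleR_matrix_vector_assoc[symmetric])
  moreover have "\<tau> * lam * wnorm_sq (matrix_inv S) z \<le> \<tau>bar * lambar * wnorm_sq (matrix_inv S) z"
    using assms wnorm_sq_inv_nonneg[OF S, of z] by (intro mult_right_mono mult_mono) auto
  ultimately have *: "c * (norm z)\<^sup>2 \<le> wnorm_sq R z - \<tau> * lam * wnorm_sq (matrix_inv S) z"
    by simp
  have "c / (2 * lambar) * (norm z)\<^sup>2 \<le> c / (2 * lam) * (norm z)\<^sup>2"
    using assms by (intro mult_right_mono divide_left_mono) auto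
  also have "\<dots> \<le> 1 / (2 * lam) * wnorm_sq R z - \<tau> / 2 * wnorm_sq (matrix_inv S) z"
    using * assms by (simp add: field_simps)
  finally show ?thesis .
qed

text \<open>Since \<open>\<tau>\<close> is nondecreasing, the weights in both bounded sums stay
  above a positive constant, so partial sums of the bare nonnegative tolerances are bounded.\<close>

lemma summable_tolerances:
  fixes \<tau> \<epsilon> \<delta> :: "nat \<Rightarrow> real"
  assumes "\<And>k. \<tau> k > 0" "mono \<tau>" "\<And>k. k \<ge> 1 \<Longrightarrow> \<epsilon> k \<ge> 0" "\<And>k. k \<ge> 1 \<Longrightarrow> \<delta> k \<ge> 0"
    and AN: "Bseq (\<lambda>N. \<Sum>k<N. \<tau> N * sqrt (\<epsilon> (Suc k) / \<tau> k))"
    and BN: "Bseq (\<lambda>N. \<Sum>k<N. \<tau> N * (2 * \<epsilon> (Suc k) + \<delta> (Suc k)))"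
  shows "summable (\<lambda>k. sqrt (\<epsilon> (Suc k)))" "summable (\<lambda>k. \<epsilon> (Suc k))" "summable (\<lambda>k. \<delta> (Suc k))"
proof -
  have summableI: "summable h"
    if "Bseq G" and h: "\<And>k. 0 \<le> h k" and le: "\<And>N. C * (\<Sum>k<N. h k) \<le> G N" and "C > 0"
    for h G :: "nat \<Rightarrow> real" and C
  proof -
    obtain K where K: "\<And>n. norm (G n) \<le> K" using \<open>Bseq G\<close> unfolding Bseq_def by blast
    show ?thesis
    proof (rule bounded_imp_summable[OF h])
      fix n
      have "C * (\<Sum>k\<le>n. h k) \<le> K"
        using le[of "Suc n"] K[of "Suc n"] by (simp add: lessThan_Suc_atMost)
      then show "(\<Sum>k\<le>n. h k) \<le> K / C" using \<open>C > 0\<close> by (simp add: field_simps)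
    qed
  qed
  have sq: "sqrt (\<tau> 0) * sqrt (\<epsilon> (Suc k)) \<le> \<tau> N * sqrt (\<epsilon> (Suc k) / \<tau> k)" if "k < N" for k N
  proof -
    \<comment> \<open>This bounds the weight \<open>\<tau> N / sqrt (\<tau> k)\<close> below by
      \<open>sqrt (\<tau> 0)\<close>, independently of \<open>k\<close> and
      \<open>N\<close>.\<close>
    have "sqrt (\<tau> 0) * sqrt (\<tau> k) \<le> sqrt (\<tau> N) * sqrt (\<tau> N)"
      using assms(1)[THEN less_imp_le] that by (intro mult_mono real_sqrt_le_mono monoD[OF assms(2)]) auto
    also have "\<dots> = \<tau> N" using assms(1)[of N] by simp
    finally have "sqrt (\<tau> 0) \<le> \<tau> N / sqrt (\<tau> k)" using assms(1)[of k] by (simp add: field_simps)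
    then have "sqrt (\<tau> 0) * sqrt (\<epsilon> (Suc k)) \<le> \<tau> N / sqrt (\<tau> k) * sqrt (\<epsilon> (Suc k))"
      using assms(3)[of "Suc k"] by (intro mult_right_mono) auto
    then show ?thesis by (simp add: real_sqrt_divide)
  qed
  show "summable (\<lambda>k. sqrt (\<epsilon> (Suc k)))"
  proof (rule summableI[OF AN, where C = "sqrt (\<tau> 0)"])
    show "sqrt (\<tau> 0) * (\<Sum>k<N. sqrt (\<epsilon> (Suc k))) \<le> (\<Sum>k<N. \<tau> N * sqrt (\<epsilon> (Suc k) / \<tau> k))" for N
      unfolding sum_distrib_left by (intro sum_mono sq) auto
  qed (use assms in auto)
  have "\<tau> 0 * (2 * \<epsilon> (Suc k) + \<delta> (Suc k)) \<le> \<tau> N * (2 * \<epsilon> (Suc k) + \<delta> (Suc k))" for k N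
    using assms by (intro mult_right_mono monoD[OF assms(2)]) auto
  then have sum: "summable (\<lambda>k. 2 * \<epsilon> (Suc k) + \<delta> (Suc k))"
    using assms by (intro summableI[OF BN, where C = "\<tau> 0"]) (auto simp: sum_distrib_left intro: sum_mono)
  show "summable (\<lambda>k. \<epsilon> (Suc k))" "summable (\<lambda>k. \<delta> (Suc k))"
    using assms(3,4) by (auto intro!: summable_comparison_test_ev[OF always_eventually sum])
qed

section \<open>Convergence of the iterates and of their averages\<close>

theorem theorem3p1:
  fixes f :: "real^'m \<Rightarrow> ereal" and g :: "real^'n \<Rightarrow> ereal"
    and A :: "real^'m^'n" and R S :: "real^'n^'n"
    and \<tau> lam \<epsilon> \<delta> :: "nat \<Rightarrow> real" and \<tau>bar lambar :: real
    and x :: "nat \<Rightarrow> real^'m" and y yb :: "nat \<Rightarrow> real^'n"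
  assumes "proper_fun f" "lsc_fun f" "convex_fun f"
    and "proper_fun g" "lsc_fun g" "convex_fun g"
    and "rank A = CARD('m)"
    and "pos_def R" "pos_def S" "pos_def (transpose A ** R ** A)"
    and "\<exists>xs ys. saddle_point f g A xs ys"
    and "\<And>k. \<tau> k > 0" "mono \<tau>" "\<And>k. lam k > 0" "mono lam"
    and "\<And>k. pos_def (R - (\<tau> k * lam k) *\<^sub>R matrix_inv S)"
    and "\<And>k. \<tau> k \<le> \<tau>bar" "\<And>k. lam k \<le> lambar"
    and "pos_def (R - (\<tau>bar * lambar) *\<^sub>R matrix_inv S)"
    and "\<And>k. k \<ge> 1 \<Longrightarrow> \<epsilon> k \<ge> 0" "\<And>k. k \<ge> 1 \<Longrightarrow> \<delta> k \<ge> 0"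
    and "inexact_pd_seq f g A R S \<tau> lam \<epsilon> \<delta> x y yb"
    and "Bseq (\<lambda>N. \<Sum>k<N. \<tau> N * sqrt (\<epsilon> (Suc k) / \<tau> k))"
    and "Bseq (\<lambda>N. \<Sum>k<N. \<tau> N * (2 * \<epsilon> (Suc k) + \<delta> (Suc k)))"
  shows "(\<forall>xh yh. cluster_point (\<lambda>N. (average x N, average y N)) (xh, yh)
            \<longrightarrow> saddle_point f g A xh yh) \<and>
         (\<exists>xh yh. saddle_point f g A xh yh \<and> x \<longlonglongrightarrow> xh \<and> y \<longlonglongrightarrow> yh)"
proof -
  note f = assms(1,2) and g = assms(4,5,6) and S = assms(9) and M = assms(10)
  note \<tau> = assms(12,13,17) and lam = assms(14,15,18) and \<epsilon> = assms(20) and \<delta> = assms(21)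
  define M where "M = transpose A ** R ** A"
  note M = M[folded M_def]
  note iter = assms(22)[unfolded inexact_pd_seq_def, folded M_def, rule_format]
  note summable = summable_tolerances[OF \<tau>(1,2) \<epsilon> \<delta> assms(23,24)]
  have bars: "0 < \<tau>bar" "0 < lambar"
    using \<tau>(1,3)[of 0] lam(1,3)[of 0] by linarith+
  have S0: "0 \<le> wnorm_sq S w" for w by (rule pos_def_nonneg[OF S])
  have M0: "0 \<le> wnorm_sq M w" for w by (rule pos_def_nonneg[OF M])
  obtain c where c: "c > 0" "\<And>z. c * (norm z)\<^sup>2 \<le> wnorm_sq (R - (\<tau>bar * lambar) *\<^sub>R matrix_inv S) z"
    using pos_def_coercive[OF assms(19)] by blast
  define a where
    "a u v k = 1 / (2 * \<tau> k) * wnorm_sq S (v - yb k) + 1 / (2 * lam k) * wnorm_sq M (u - x k)" for u v k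
  \<comment> \<open>The weights use the upper bounds of the step sizes, so they do not depend on
    \<open>k\<close> and \<open>P\<close> tending to 0 controls both differences.\<close>
  define P where "P k = c / (2 * lambar) * (norm (A *v (x k - x (Suc k))))\<^sup>2
    + 1 / (2 * \<tau>bar) * wnorm_sq S (yb k - y (Suc k))" for k
  have a0: "0 \<le> a u v k" for u v k
    using S0 M0 \<tau>(1)[of k] lam(1)[of k] by (simp add: a_def)
  have P0: "0 \<le> P k" for k
    using S0 c bars by (simp add: P_def)

  \<comment> \<open>Stated for every saddle point because it serves twice: at a given one for
    boundedness, later at the limit point for convergence.\<close>
  have fejer: thesis
    if saddle: "saddle_point f g A u v"
      and that: "\<And>\<sigma>. \<lbrakk>summable \<sigma>; \<And>k. 0 \<le> \<sigma> k; \<And>k. a u v (Suc k) + P k \<le> a u v k + \<sigma> k\<rbrakk> \<Longrightarrow> thesis"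
    for u v thesis
  proof -
    \<comment> \<open>New iterates with the old step sizes, as the one-step estimate yields them;
      monotone step sizes then give \<open>next_le\<close>.\<close>
    define a' where "a' k = 1 / (2 * \<tau> k) * wnorm_sq S (v - yb (Suc k))
      + 1 / (2 * lam k) * wnorm_sq M (u - x (Suc k))" for k
    have next_le: "a u v (Suc k) \<le> a' k" for k
      unfolding a_def a'_def using S0 M0 \<tau> lam
      by (intro add_mono mult_right_mono divide_left_mono) (auto simp: monoD)
    have rec: "a' k + P k \<le> a u v k + (\<delta> (Suc k) + 3 / 2 * \<epsilon> (Suc k))
        + (sqrt 2 * sqrt (\<epsilon> (Suc k))) * sqrt (a' k)" for k
    proof -
      define Q where "Q = 1 / (2 * \<tau> k) * wnorm_sq S (v - yb (Suc k))"
      have e: "0 \<le> \<epsilon> (Suc k)" using \<epsilon> by simp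
      have "0 \<le> 1 / (2 * lam k) * wnorm_sq M (u - x (Suc k))"
        using M0 lam(1)[of k] by simp
      then have "sqrt (2 * \<epsilon> (Suc k) * Q) \<le> sqrt (2 * \<epsilon> (Suc k) * a' k)"
        using e by (intro real_sqrt_le_mono mult_left_mono) (auto simp: Q_def a'_def)
      also have "\<dots> = (sqrt 2 * sqrt (\<epsilon> (Suc k))) * sqrt (a' k)"
        by (simp add: real_sqrt_mult)
      finally have root: "sqrt (2 * \<epsilon> (Suc k) * Q) \<le> (sqrt 2 * sqrt (\<epsilon> (Suc k))) * sqrt (a' k)" .
      have gap: "c / (2 * lambar) * (norm (A *v (x k - x (Suc k))))\<^sup>2
          \<le> 1 / (2 * lam k) * wnorm_sq M (x k - x (Suc k))
            - \<tau> k / 2 * wnorm_sq (matrix_inv S) (A *v (x k - x (Suc k)))"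
        unfolding M_def wnorm_sq_congruence
        using c(1) by (intro proximal_gap_bound[OF S c(2)] \<tau> lam) simp
      have "1 / (2 * \<tau>bar) * wnorm_sq S (yb k - y (Suc k)) \<le> 1 / (2 * \<tau> k) * wnorm_sq S (yb k - y (Suc k))"
        using \<tau>(1,3)[of k] bars S0 by (intro mult_right_mono divide_left_mono) auto
      then show ?thesis
        using inexact_step_descent[OF f(1) g(1,3) S M \<tau>(1) lam(1) e
            iter[of k, THEN conjunct1] iter[of k, THEN conjunct2, THEN conjunct1]
            iter[of k, THEN conjunct2, THEN conjunct2] saddle] root gap
        unfolding a_def a'_def P_def Q_def by linarith
    qed
    show thesis
    proof (rule quasi_fejer_sqrt[where a = "a u v" and a' = a' and P = P
          and \<eta> = "\<lambda>k. \<delta> (Suc k) + 3 / 2 * \<epsilon> (Suc k)" and s = "\<lambda>k. sqrt 2 * sqrt (\<epsilon> (Suc k))",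
          OF a0 P0 _ _ next_le rec])
      show "summable (\<lambda>k. \<delta> (Suc k) + 3 / 2 * \<epsilon> (Suc k))"
        by (intro summable_add summable_mult summable)
      show "summable (\<lambda>k. sqrt 2 * sqrt (\<epsilon> (Suc k)))"
        by (intro summable_mult summable)
    qed (use \<epsilon> \<delta> that in auto)
  qed

  obtain us vs where "saddle_point f g A us vs" using assms(11) by blast
  then obtain \<sigma> where \<sigma>: "summable \<sigma>" "\<And>k. 0 \<le> \<sigma> k"
      "\<And>k. a us vs (Suc k) + P k \<le> a us vs k + \<sigma> k"
    using fejer by blast
  note quasi = quasi_fejer[of "a us vs" P \<sigma>, OF a0 P0 \<sigma>(2,3,1)]
  define B where "B = a us vs 0 + suminf \<sigma>"
  have aB: "a us vs k \<le> B" for k using quasi(1) by (simp add: B_def)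

  have dyb: "(\<lambda>k. yb k - y (Suc k)) \<longlonglongrightarrow> 0"
  proof (rule pos_def_tendsto_zero[OF S])
    have "wnorm_sq S (yb k - y (Suc k)) \<le> 2 * \<tau>bar * P k" for k
      using bars c by (simp add: P_def field_simps)
    then show "(\<lambda>k. wnorm_sq S (yb k - y (Suc k))) \<longlonglongrightarrow> 0"
      by (rule tendsto_zero_dominated[OF quasi(2) S0])
  qed
  \<comment> \<open>\<open>P\<close> sees only the image under \<open>A\<close>; its
    \<open>R\<close>-norm is the \<open>M\<close>-norm of the difference, and \<open>M\<close> is
    definite.\<close>
  have dx: "(\<lambda>k. x k - x (Suc k)) \<longlonglongrightarrow> 0"
  proof (rule pos_def_tendsto_zero[OF M])
    have "(norm (A *v (x k - x (Suc k))))\<^sup>2 \<le> 2 * lambar / c * P k" for k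
      using bars c S0 by (simp add: P_def field_simps)
    then have "(\<lambda>k. (norm (A *v (x k - x (Suc k))))\<^sup>2) \<longlonglongrightarrow> 0"
      by (rule tendsto_zero_dominated[OF quasi(2) zero_le_power2])
    then have "(\<lambda>k. A *v (x k - x (Suc k))) \<longlonglongrightarrow> 0"
      by (simp add: power_tendsto_0_iff tendsto_norm_zero_iff)
    from tendsto_wnorm_sq[OF this, of R] show "(\<lambda>k. wnorm_sq M (x k - x (Suc k))) \<longlonglongrightarrow> 0"
      by (simp add: M_def wnorm_sq_congruence) (simp add: wnorm_sq_def)
  qed

  \<comment> \<open>The upper bounds on the step sizes keep the weights in \<open>a\<close> away
    from 0, so bounded \<open>a\<close> means bounded iterates.\<close>
  have "bounded (range (\<lambda>k. (x k, yb k)))"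
  proof -
    have "bounded (range x)"
    proof (rule pos_def_bounded_range[OF M])
      fix k
      have "1 / (2 * lambar) * wnorm_sq M (us - x k) \<le> 1 / (2 * lam k) * wnorm_sq M (us - x k)"
        using lam(1,3)[of k] bars M0 by (intro mult_right_mono divide_left_mono) auto
      also have "\<dots> \<le> B" using aB[of k] S0 \<tau>(1)[of k] by (simp add: a_def add_increasing)
          (smt (verit) S0 divide_nonneg_pos mult_pos_pos)
      finally show "wnorm_sq M (us - x k) \<le> B * (2 * lambar)" using bars by (simp add: field_simps)
    qed
    moreover have "bounded (range yb)"
    proof (rule pos_def_bounded_range[OF S])
      fix k
      have "1 / (2 * \<tau>bar) * wnorm_sq S (vs - yb k) \<le> 1 / (2 * \<tau> k) * wnorm_sq S (vs - yb k)"
        using \<tau>(1,3)[of k] bars S0 by (intro mult_right_mono divide_left_mono) auto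
      also have "\<dots> \<le> B" using aB[of k] M0 lam(1)[of k] by (simp add: a_def)
          (smt (verit) M0 divide_nonneg_pos mult_pos_pos)
      finally show "wnorm_sq S (vs - yb k) \<le> B * (2 * \<tau>bar)" using bars by (simp add: field_simps)
    qed
    ultimately have "bounded (range x \<times> range yb)" by (rule bounded_Times)
    then show ?thesis by (rule bounded_subset) auto
  qed
  then obtain l and r :: "nat \<Rightarrow> nat" where r: "strict_mono r" and "((\<lambda>k. (x k, yb k)) \<circ> r) \<longlonglongrightarrow> l"
    using bounded_imp_convergent_subsequence by blast
  moreover obtain xh yh where "l = (xh, yh)" by fastforce
  ultimately have "(\<lambda>j. (x (r j), yb (r j))) \<longlonglongrightarrow> (xh, yh)" by (simp add: o_def)
  from tendsto_fst[OF this] tendsto_snd[OF this]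
  have xr: "(\<lambda>j. x (r j)) \<longlonglongrightarrow> xh" and ybr: "(\<lambda>j. yb (r j)) \<longlonglongrightarrow> yh" by simp_all
  \<comment> \<open>Since successive differences vanish, the shifted iterates in the inclusions have
    the same subsequential limits.\<close>
  have sub: "(\<lambda>j. h (r j)) \<longlonglongrightarrow> h'" if "h \<longlonglongrightarrow> h'" for h :: "nat \<Rightarrow> 'z::topological_space" and h'
    using LIMSEQ_subseq_LIMSEQ[OF that r] by (simp add: o_def)
  have xSr: "(\<lambda>j. x (Suc (r j))) \<longlonglongrightarrow> xh"
    using tendsto_diff[OF xr sub[OF dx]] by simp
  have ySr: "(\<lambda>j. y (Suc (r j))) \<longlonglongrightarrow> yh"
    using tendsto_diff[OF ybr sub[OF dyb]] by simp
  \<comment> \<open>Nondecreasing positive step sizes stay above their value at 0, so their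
    reciprocals are bounded.\<close>
  have inv_bounded: "(\<lambda>j. (1 / s (r j)) *\<^sub>R w j) \<longlonglongrightarrow> 0"
    if "w \<longlonglongrightarrow> 0" and s: "\<And>k. s k > 0" "mono s" for s :: "nat \<Rightarrow> real" and w :: "nat \<Rightarrow> 'z::real_normed_vector"
  proof (rule Lim_null_comparison)
    show "(\<lambda>j. 1 / s 0 * norm (w j)) \<longlonglongrightarrow> 0" using tendsto_mult_right_zero tendsto_norm_zero that(1) by blast
    have "norm ((1 / s (r j)) *\<^sub>R w j) \<le> 1 / s 0 * norm (w j)" for j
      using s(1)[of "r j"] s(1)[of 0] monoD[OF s(2), of 0 "r j"]
      by (simp add: divide_left_mono)
    then show "\<forall>\<^sub>F j in sequentially. norm ((1 / s (r j)) *\<^sub>R w j) \<le> 1 / s 0 * norm (w j)" by simp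
  qed
  note mv_tendsto = bounded_linear.tendsto[OF matrix_vector_mul_bounded_linear]
  \<comment> \<open>Passes to the limit in the two type-2 inclusions; the proximal terms and the
    tolerances vanish.\<close>
  have saddle: "saddle_point f g A xh yh"
    unfolding saddle_point_iff_subdiff[OF f(1) g(1)]
  proof
    have "(\<lambda>j. (1 / lam (r j)) *\<^sub>R (M *v (x (r j) - x (Suc (r j)))) - transpose A *v y (Suc (r j)))
        \<longlonglongrightarrow> 0 - transpose A *v yh"
      using mv_tendsto[OF sub[OF dx], of M]
      by (intro tendsto_diff mv_tendsto ySr inv_bounded lam) simp
    from eps_subdiff_closed[OF f _ this xSr sub[OF summable_LIMSEQ_zero[OF summable(3)]]]
    show "- (transpose A *v yh) \<in> eps_subdiff 0 f xh" using iter by simp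
    have p: "(\<lambda>j. (1 / \<tau> (r j)) *\<^sub>R (S *v (yb (r j) - y (Suc (r j)))) + A *v x (r j)) \<longlonglongrightarrow> 0 + A *v xh"
      using mv_tendsto[OF sub[OF dyb], of S]
      by (intro tendsto_add mv_tendsto xr inv_bounded \<tau>) simp
    have "(\<lambda>j. \<epsilon> (Suc (r j)) / 2) \<longlonglongrightarrow> 0"
      by (intro tendsto_divide_zero sub[OF summable_LIMSEQ_zero[OF summable(2)]])
    from eps_subdiff_closed[OF g(1,2) _ p ySr this]
    show "A *v xh \<in> eps_subdiff 0 g yh" using iter by simp
  qed

  \<comment> \<open>Both squared distances vanish along \<open>r\<close> and their weights are
    bounded; \<open>quasi_fejer(3)\<close> then extends this to the whole sequence.\<close>
  have ar: "(a xh yh \<circ> r) \<longlonglongrightarrow> 0"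
  proof -
    have "(\<lambda>j. (1 / (2 * \<tau> (r j))) *\<^sub>R wnorm_sq S (yh - yb (r j))
        + (1 / (2 * lam (r j))) *\<^sub>R wnorm_sq M (xh - x (r j))) \<longlonglongrightarrow> 0 + 0"
      using tendsto_wnorm_sq[OF tendsto_diff[OF tendsto_const[of yh] ybr], of S]
        tendsto_wnorm_sq[OF tendsto_diff[OF tendsto_const[of xh] xr], of M] \<tau> lam
      by (intro tendsto_add inv_bounded[of _ "\<lambda>k. 2 * \<tau> k"] inv_bounded[of _ "\<lambda>k. 2 * lam k"])
        (auto simp: wnorm_sq_def mono_def)
    then show ?thesis by (simp add: a_def o_def)
  qed
  have alim: "a xh yh \<longlonglongrightarrow> 0"
  proof (rule fejer[OF saddle])
    fix \<sigma> assume "summable \<sigma>" "\<And>k. 0 \<le> \<sigma> k" "\<And>k. a xh yh (Suc k) + P k \<le> a xh yh k + \<sigma> k"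
    then show ?thesis using quasi_fejer(3)[of "a xh yh" P \<sigma>, OF a0 P0 _ _ _ r ar] by simp
  qed
  have "(\<lambda>k. yh - yb k) \<longlonglongrightarrow> 0"
  proof (rule pos_def_tendsto_zero[OF S])
    have "wnorm_sq S (yh - yb k) \<le> 2 * \<tau>bar * a xh yh k" for k
    proof -
      have "1 / (2 * \<tau>bar) * wnorm_sq S (yh - yb k) \<le> 1 / (2 * \<tau> k) * wnorm_sq S (yh - yb k)"
        using \<tau>(1,3)[of k] bars S0 by (intro mult_right_mono divide_left_mono) auto
      also have "\<dots> \<le> a xh yh k" using M0 lam(1)[of k] by (simp add: a_def)
      finally show ?thesis using bars by (simp add: field_simps)
    qed
    then show "(\<lambda>k. wnorm_sq S (yh - yb k)) \<longlonglongrightarrow> 0"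
      by (rule tendsto_zero_dominated[OF alim S0])
  qed
  \<comment> \<open>The expression collapses to \<open>y (Suc k)\<close>; the index shift is removed
    next.\<close>
  then have "(\<lambda>k. yh - (yh - yb k) - (yb k - y (Suc k))) \<longlonglongrightarrow> yh - 0 - 0"
    by (intro tendsto_diff tendsto_const dyb)
  then have ylim: "y \<longlonglongrightarrow> yh" by (simp add: LIMSEQ_imp_Suc)
  have "(\<lambda>k. xh - x k) \<longlonglongrightarrow> 0"
  proof (rule pos_def_tendsto_zero[OF M])
    have "wnorm_sq M (xh - x k) \<le> 2 * lambar * a xh yh k" for k
    proof -
      have "1 / (2 * lambar) * wnorm_sq M (xh - x k) \<le> 1 / (2 * lam k) * wnorm_sq M (xh - x k)"
        using lam(1,3)[of k] bars M0 by (intro mult_right_mono divide_left_mono) auto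
      also have "\<dots> \<le> a xh yh k" using S0 \<tau>(1)[of k] by (simp add: a_def)
      finally show ?thesis using bars by (simp add: field_simps)
    qed
    then show "(\<lambda>k. wnorm_sq M (xh - x k)) \<longlonglongrightarrow> 0"
      by (rule tendsto_zero_dominated[OF alim M0])
  qed
  then have "(\<lambda>k. xh - (xh - x k)) \<longlonglongrightarrow> xh - 0" by (intro tendsto_diff tendsto_const)
  then have xlim: "x \<longlonglongrightarrow> xh" by simp
  \<comment> \<open>The averages converge as a whole, so \<open>(xh, yh)\<close> is their only
    cluster point.\<close>
  have avg: "(\<lambda>N. (average x N, average y N)) \<longlonglongrightarrow> (xh, yh)"
    by (intro tendsto_Pair average_tendsto xlim ylim)
  have "saddle_point f g A xc yc"
    if cluster: "cluster_point (\<lambda>N. (average x N, average y N)) (xc, yc)" for xc yc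
  proof -
    obtain q :: "nat \<Rightarrow> nat" where q: "strict_mono q" "((\<lambda>N. (average x N, average y N)) \<circ> q) \<longlonglongrightarrow> (xc, yc)"
      using cluster unfolding cluster_point_def by blast
    have "(xc, yc) = (xh, yh)"
      by (rule LIMSEQ_unique[OF q(2) LIMSEQ_subseq_LIMSEQ[OF avg q(1)]])
    then show ?thesis using saddle by simp
  qed
  then show ?thesis using saddle xlim ylim by (intro conjI allI impI exI[of _ xh] exI[of _ yh])
qed

end
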